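(* For every $\varepsilon>0$ there exists $d_0$ such that, for every fixed integer $d\ge d_0$, a uniformly random $d$-regular graph $G\sim G_{n,d}$ on $[n]$ satisfies $\mu(G)\ge 2^{(1-\varepsilon)n}$ whp.
   Context: For a finite graph $G$, $\mu(G)$ denotes the number of pairwise non-isomorphic induced subgraphs of $G$, i.e. the number of isomorphism classes among the graphs $G[U]$, $U\subset V(G)$. $G_{n,d}$ is the uniform distribution on the set of all (simple, labelled) $d$-regular graphs on vertex set $[n]=\{1,\dots,n\}$, where $dn$ is even. "Whp" means with probability tending to $1$ as $n\to\infty$ (along those $n$ for which $dn$ is even), with $d$ fixed. *)

theory Defs
  imports "HOL-Probability.Probability" "Graph_Theory.Pair_Digraph"
    "Graph_Theory.Digraph_Isomorphism"
begin

text \<open>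
  A finite simple graph is a \<^term>\<open>pair_graph\<close>: a finite vertex set together with a symmetric,
  irreflexive set of ordered pairs of vertices. The edge \<open>uv\<close> is the pair of opposite arcs
  \<open>(u, v)\<close>, \<open>(v, u)\<close>, so these structures correspond one-to-one to labelled simple graphs, and the
  out-degree of a vertex is its degree.
\<close>

definition induced_subgraphs :: "'a pair_pre_digraph \<Rightarrow> ('a, 'a \<times> 'a) pre_digraph set" where
  "induced_subgraphs G = {induce_subgraph (with_proj G) U | U. U \<subseteq> pverts G}"

definition induced_iso_rel :: "'a pair_pre_digraph \<Rightarrow> ('a, 'a \<times> 'a) pre_digraph rel" where
  "induced_iso_rel G =
    {(H, K). H \<in> induced_subgraphs G \<and> K \<in> induced_subgraphs G \<and> digraph_iso H K}"

definition mu :: "'a pair_pre_digraph \<Rightarrow> nat" where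
  "mu G = card (induced_subgraphs G // induced_iso_rel G)"

definition regular_graphs :: "nat \<Rightarrow> nat \<Rightarrow> nat pair_pre_digraph set" where
  "regular_graphs n d =
    {G. pair_graph G \<and> pverts G = {1..n} \<and> (\<forall>v\<in>pverts G. out_degree (with_proj G) v = d)}"

text \<open>
  \<^const>\<open>pmf_of_set\<close> is the uniform distribution only on a finite nonempty set. Here the set is
  always finite, and it is nonempty whenever \<open>d * n\<close> is even and \<open>d < n\<close>, hence for all but finitely
  many of the relevant \<open>n\<close>.
\<close>
definition random_regular_graph :: "nat \<Rightarrow> nat \<Rightarrow> nat pair_pre_digraph pmf" where
  "random_regular_graph n d = pmf_of_set (regular_graphs n d)"

lemma finite_regular_graphs: "finite (regular_graphs n d)"
proof (rule finite_subset)
  let ?g = "\<lambda>A. \<lparr>pverts = {1..n}, parcs = A\<rparr> :: nat pair_pre_digraph"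
  show "regular_graphs n d \<subseteq> ?g ` Pow ({1..n} \<times> {1..n})"
  proof
    fix G assume G: "G \<in> regular_graphs n d"
    then interpret pair_graph G by (simp add: regular_graphs_def)
    have "parcs G \<subseteq> pverts G \<times> pverts G"
      using arc_fst_in_verts arc_snd_in_verts by force
    moreover have "pverts G = {1..n}" using G by (simp add: regular_graphs_def)
    ultimately show "G \<in> ?g ` Pow ({1..n} \<times> {1..n})"
      by (intro image_eqI[of _ _ "parcs G"]) auto
  qed
qed simp

lemma wf_digraph_induced_subgraphs:
  assumes "H \<in> induced_subgraphs G"
  shows "wf_digraph H"
  using assms by (auto simp: induced_subgraphs_def wf_digraph_def)

lemma digraph_iso_refl:
  assumes "wf_digraph H"
  shows "digraph_iso H H"
  unfolding digraph_iso_def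
proof (intro exI conjI)
  let ?f = "\<lparr>iso_verts = id, iso_arcs = id, iso_head = head H, iso_tail = tail H\<rparr>"
  show "pre_digraph.digraph_isomorphism H ?f"
    using assms by (auto simp: pre_digraph.digraph_isomorphism_def)
  show "H = app_iso ?f H" by (simp add: app_iso_def)
qed

lemma equiv_induced_iso_rel: "equiv (induced_subgraphs G) (induced_iso_rel G)"
proof (rule equivI)
  show "induced_iso_rel G \<subseteq> induced_subgraphs G \<times> induced_subgraphs G"
    by (auto simp: induced_iso_rel_def)
  show "refl_on (induced_subgraphs G) (induced_iso_rel G)"
    by (auto simp: refl_on_def induced_iso_rel_def
        intro: digraph_iso_refl wf_digraph_induced_subgraphs)
  show "sym (induced_iso_rel G)"
    by (auto simp: sym_def induced_iso_rel_def
        intro: digraph_iso_swap wf_digraph_induced_subgraphs)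
  show "trans (induced_iso_rel G)"
    by (auto simp: trans_def induced_iso_rel_def intro: digraph_iso_trans)
qed

text \<open>For induced subgraphs, \<^const>\<open>digraph_iso\<close> is the usual notion of graph isomorphism.\<close>
lemma digraph_iso_induce_subgraph_iff:
  "digraph_iso (induce_subgraph (with_proj G) U) (induce_subgraph (with_proj G) W) \<longleftrightarrow>
    (\<exists>f. bij_betw f U W \<and>
      (\<forall>u\<in>U. \<forall>v\<in>U. (u, v) \<in> parcs G \<longleftrightarrow> (f u, f v) \<in> parcs G))"
  (is "digraph_iso ?H ?K \<longleftrightarrow> ?R")
proof
  assume "digraph_iso ?H ?K"
  then obtain h where h: "pre_digraph.digraph_isomorphism ?H h" and K: "?K = app_iso h ?H"
    by (auto simp: digraph_iso_def)
  interpret H: wf_digraph ?H using h by (simp add: pre_digraph.digraph_isomorphism_def)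
  have W: "W = iso_verts h ` U" using arg_cong[OF K, of verts] by simp
  have inj: "inj_on (iso_verts h) U"
    using h by (simp add: pre_digraph.digraph_isomorphism_def)
  have ends: "arcs_ends ?K = (\<lambda>(u, v). (iso_verts h u, iso_verts h v)) ` arcs_ends ?H"
    unfolding K by (rule H.arcs_ends_app_iso_eq[OF h])
  have ae: "(u, v) \<in> arcs_ends (induce_subgraph (with_proj G) S) \<longleftrightarrow>
      (u, v) \<in> parcs G \<and> u \<in> S \<and> v \<in> S" for u v S
    by (force simp: arcs_ends_conv)
  have "(u, v) \<in> parcs G \<longleftrightarrow> (iso_verts h u, iso_verts h v) \<in> parcs G"
    if "u \<in> U" "v \<in> U" for u v
  proof -
    have "(u, v) \<in> parcs G \<longleftrightarrow> (u, v) \<in> arcs_ends ?H" using that by (simp add: ae)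
    also have "\<dots> \<longleftrightarrow> (iso_verts h u, iso_verts h v) \<in> arcs_ends ?K"
    proof
      assume "(iso_verts h u, iso_verts h v) \<in> arcs_ends ?K"
      then obtain u' v' where uv: "(u', v') \<in> arcs_ends ?H"
        and eq: "iso_verts h u = iso_verts h u'" "iso_verts h v = iso_verts h v'"
        unfolding ends by auto
      have "u = u'" "v = v'" using eq uv inj that by (auto simp: ae dest: inj_onD)
      then show "(u, v) \<in> arcs_ends ?H" using uv by simp
    qed (force simp: ends)
    also have "\<dots> \<longleftrightarrow> (iso_verts h u, iso_verts h v) \<in> parcs G" using that W by (simp add: ae)
    finally show ?thesis .
  qed
  then show ?R using W inj by (intro exI[of _ "iso_verts h"]) (auto simp: bij_betw_def)
next
  assume ?R
  then obtain f where f: "bij_betw f U W"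
    and adj: "\<And>u v. u \<in> U \<Longrightarrow> v \<in> U \<Longrightarrow> (u, v) \<in> parcs G \<longleftrightarrow> (f u, f v) \<in> parcs G"
    by blast
  let ?h = "\<lparr>iso_verts = f, iso_arcs = map_prod f f, iso_head = snd, iso_tail = fst\<rparr>"
  have inj: "inj_on f U" and W: "W = f ` U" using f by (auto simp: bij_betw_def)
  show "digraph_iso ?H ?K"
    unfolding digraph_iso_def
  proof (intro exI conjI)
    show "pre_digraph.digraph_isomorphism ?H ?h"
      using inj by (auto simp: pre_digraph.digraph_isomorphism_def wf_digraph_def inj_on_def)
    show "?K = app_iso ?h ?H"
      using W adj by (auto simp: app_iso_def induce_subgraph_def with_proj_def image_iff) force
  qed
qed

end

theory Submission
  imports Defs
begin

text \<open>
  Call a set \<open>U\<close> of vertices typical if all but at most \<open>\<delta> n / 2\<close> vertices have at least \<open>K\<close>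
  neighbours in \<open>U\<close>. In a \<open>d\<close>-regular graph with \<open>d\<close> large, at least half of all sets are typical. If
  an isomorphism from \<open>G[U]\<close> to \<open>G[W]\<close> with \<open>U\<close> typical moved at least \<open>\<delta> n\<close> vertices, it would move so
  many edges that \<open>G\<close> contained \<open>2 n\<close> edges together with a disjoint copy of them under a map of the
  vertex set. A switching argument bounds the probability that \<open>G\<close> contains a given set of \<open>4 n\<close> edges
  by \<open>(2 d / n) ^ (4 n)\<close>, so by a union bound there is no such copy whp. Hence \<open>W\<close> differs from \<open>U\<close> in
  fewer than \<open>2 \<delta> n\<close> vertices, the isomorphism classes of typical sets have at most
  \<open>2 powr (\<epsilon> n / 2)\<close> members, and there are at least \<open>2 powr ((1 - \<epsilon>) n)\<close> of them.
\<close>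

section \<open>Switchings in regular graphs\<close>

definition edges_on :: "'a set \<Rightarrow> 'a set set" where
  "edges_on V = {e. e \<subseteq> V \<and> card e = 2}"

definition nbrs :: "'a set set \<Rightarrow> 'a \<Rightarrow> 'a set" where
  "nbrs E v = {w. {v, w} \<in> E}"

text \<open>Edges are unordered pairs here rather than arcs, so that one switching replaces exactly
  two elements of the graph and a vertex map acts on an edge simply by taking its image.\<close>

definition regular_edge_sets :: "'a set \<Rightarrow> nat \<Rightarrow> 'a set set set" where
  "regular_edge_sets V d = {E. E \<subseteq> edges_on V \<and> (\<forall>v\<in>V. card (nbrs E v) = d)}"

lemma doubleton_in_edges_on: "{u, v} \<in> edges_on V \<longleftrightarrow> u \<in> V \<and> v \<in> V \<and> u \<noteq> v"
  by (auto simp: edges_on_def card_2_iff doubleton_eq_iff)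

lemma edges_onE:
  assumes "e \<in> edges_on V"
  obtains u v where "e = {u, v}" "u \<in> V" "v \<in> V" "u \<noteq> v"
  using assms by (auto simp: edges_on_def card_2_iff)

lemma edge_memD:
  assumes "E \<subseteq> edges_on V" "{u, v} \<in> E"
  shows "u \<in> V" "v \<in> V" "u \<noteq> v"
  using assms doubleton_in_edges_on[of u v V] by auto

lemma finite_edges_on: "finite V \<Longrightarrow> finite (edges_on V)"
  by (simp add: edges_on_def)

lemma card_edges_on_le:
  assumes "finite V"
  shows "card (edges_on V) \<le> (card V)\<^sup>2"
proof -
  have "edges_on V \<subseteq> (\<lambda>(u, v). {u, v}) ` (V \<times> V)"
    by (auto elim!: edges_onE)
  then have "card (edges_on V) \<le> card (V \<times> V)"
    using assms by (intro surj_card_le) auto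
  then show ?thesis by (simp add: card_cartesian_product power2_eq_square)
qed

lemma finite_regular_edge_sets: "finite V \<Longrightarrow> finite (regular_edge_sets V d)"
  by (rule finite_subset[of _ "Pow (edges_on V)"])
    (auto simp: regular_edge_sets_def finite_edges_on)

lemma nbrs_subset: "E \<subseteq> edges_on V \<Longrightarrow> nbrs E v \<subseteq> V"
  by (auto simp: nbrs_def dest: edge_memD)

lemma mem_nbrs: "w \<in> nbrs E v \<longleftrightarrow> {v, w} \<in> E"
  by (simp add: nbrs_def)

section \<open>Bounds for double counting\<close>

lemma card_ordered_pairs_le:
  assumes "finite F"
  shows "finite {(x, y). {x, y} \<in> F}" and "card {(x, y). {x, y} \<in> F} \<le> 2 * card F"
proof -
  have 1: "finite {(x, y). {x, y} = e} \<and> card {(x, y). {x, y} = e} \<le> 2" for e :: "'a set"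
  proof (cases "\<exists>a b. e = {a, b}")
    case True
    then obtain a b where "e = {a, b}" by blast
    then have sub: "{(x, y). {x, y} = e} \<subseteq> {(a, b), (b, a)}"
      by (auto simp: doubleton_eq_iff)
    have "card {(x, y). {x, y} = e} \<le> card {(a, b), (b, a)}"
      by (rule card_mono[OF _ sub]) simp
    also have "\<dots> \<le> 2" by (cases "a = b") auto
    finally have "card {(x, y). {x, y} = e} \<le> 2" .
    moreover have "finite {(x, y). {x, y} = e}"
      by (rule finite_subset[OF sub]) blast
    ultimately show ?thesis by blast
  next
    case False
    then have "{(x, y). {x, y} = e} = {}" by auto
    then show ?thesis by simp
  qed
  have eq: "{(x, y). {x, y} \<in> F} = (\<Union>e\<in>F. {(x, y). {x, y} = e})" by auto
  show "finite {(x, y). {x, y} \<in> F}" unfolding eq using 1 assms by blast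
  have "card (\<Union>e\<in>F. {(x, y). {x, y} = e}) \<le> (\<Sum>e\<in>F. card {(x, y). {x, y} = e})"
    by (rule card_UN_le[OF assms])
  also have "\<dots> \<le> (\<Sum>e\<in>F. 2)" by (rule sum_mono) (use 1 in blast)
  finally show "card {(x, y). {x, y} \<in> F} \<le> 2 * card F" unfolding eq by simp
qed

lemma card_Sigma_le:
  assumes "finite A" "\<And>a. a \<in> A \<Longrightarrow> finite (B a) \<and> card (B a) \<le> m"
  shows "card (Sigma A B) \<le> card A * m"
proof -
  have "card (Sigma A B) = (\<Sum>a\<in>A. card (B a))"
    using assms by (intro card_SigmaI) auto
  also have "\<dots> \<le> (\<Sum>a\<in>A. m)" using assms by (intro sum_mono) auto
  finally show ?thesis by simp
qed

lemma card_Sigma_ge: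
  assumes "finite A" "\<And>a. a \<in> A \<Longrightarrow> finite (B a) \<and> m \<le> card (B a)"
  shows "card A * m \<le> card (Sigma A B)"
proof -
  have "(\<Sum>a\<in>A. m) \<le> (\<Sum>a\<in>A. card (B a))" using assms by (intro sum_mono) auto
  also have "\<dots> = card (Sigma A B)"
    using assms by (intro card_SigmaI[symmetric]) auto
  finally show ?thesis by simp
qed

text \<open>The order of \<open>x\<close> and \<open>y\<close> matters: one edge offers two
  switchings with \<open>uv\<close>, so choices are counted as ordered pairs below.\<close>

definition switch :: "'a \<Rightarrow> 'a \<Rightarrow> 'a set set \<Rightarrow> 'a \<Rightarrow> 'a \<Rightarrow> 'a set set" where
  "switch u v E x y = (E - {{u, v}, {x, y}}) \<union> {{u, x}, {v, y}}"

text \<open>Each of \<open>u\<close>, \<open>v\<close>, \<open>x\<close>, \<open>y\<close> trades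
  one neighbour for another, so no degree changes. The conditions on \<open>x\<close> and
  \<open>y\<close> rule out loops and edges that are already present.\<close>

lemma switch_regular:
  assumes "finite V" "E \<in> regular_edge_sets V d" "{u, v} \<in> E" "{x, y} \<in> E"
    and x: "x \<notin> insert u (nbrs E u)" and y: "y \<notin> insert v (nbrs E v)"
  shows "switch u v E x y \<in> regular_edge_sets V d"
proof -
  have E: "E \<subseteq> edges_on V" and deg: "\<And>w. w \<in> V \<Longrightarrow> card (nbrs E w) = d"
    using assms by (auto simp: regular_edge_sets_def)
  have V: "u \<in> V" "v \<in> V" "x \<in> V" "y \<in> V" "u \<noteq> v" "x \<noteq> y"
    using edge_memD[OF E assms(3)] edge_memD[OF E assms(4)] by auto
  have ne: "x \<noteq> u" "y \<noteq> v" using x y by auto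
  have ux: "{u, x} \<notin> E" "{x, u} \<notin> E" "{v, y} \<notin> E" "{y, v} \<notin> E"
    using x y by (auto simp: nbrs_def insert_commute)
  \<comment> \<open>\<open>v\<close> is a neighbour of \<open>u\<close> and \<open>x\<close> is not,
    hence they differ; likewise for \<open>y\<close> and \<open>u\<close>.\<close>
  have ne2: "x \<noteq> v" "y \<noteq> u" using ux assms(3,4) by (auto simp: insert_commute)
  have fin: "finite (nbrs E w)" for w
    using finite_subset[OF nbrs_subset[OF E] assms(1)] .
  have swap: "card (insert b (nbrs E w - {a})) = d"
    if "w \<in> V" "a \<in> nbrs E w" "b \<notin> nbrs E w" for a b w
  proof -
    have "card (nbrs E w) > 0" using that fin card_gt_0_iff by blast
    then show ?thesis using that deg[OF that(1)] fin[of w] by (simp add: card.insert)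
  qed
  let ?E = "switch u v E x y"
  have mem: "v \<in> nbrs E u" "u \<in> nbrs E v" "y \<in> nbrs E x" "x \<in> nbrs E y"
    "x \<notin> nbrs E u" "u \<notin> nbrs E x" "y \<notin> nbrs E v" "v \<notin> nbrs E y"
    using assms(3,4) ux by (simp_all only: mem_nbrs insert_commute)
  have "card (nbrs ?E w) = d" if w: "w \<in> V" for w
  proof -
    consider "w = u" | "w = v" | "w = x" | "w = y" | "w \<notin> {u, v, x, y}" by blast
    then show ?thesis
    proof cases
      case 1
      have "nbrs ?E u = insert x (nbrs E u - {v})"
        using V ne ne2 by (auto simp: nbrs_def switch_def doubleton_eq_iff)
      then show ?thesis using 1 swap[of u v x] V mem by simp
    next
      case 2
      have "nbrs ?E v = insert y (nbrs E v - {u})"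
        using V ne ne2 by (auto simp: nbrs_def switch_def doubleton_eq_iff)
      then show ?thesis using 2 swap[of v u y] V mem by simp
    next
      case 3
      have "nbrs ?E x = insert u (nbrs E x - {y})"
        using V ne ne2 by (auto simp: nbrs_def switch_def doubleton_eq_iff)
      then show ?thesis using 3 swap[of x y u] V mem by simp
    next
      case 4
      have "nbrs ?E y = insert v (nbrs E y - {x})"
        using V ne ne2 by (auto simp: nbrs_def switch_def doubleton_eq_iff)
      then show ?thesis using 4 swap[of y x v] V mem by simp
    next
      case 5
      then have "nbrs ?E w = nbrs E w"
        by (auto simp: nbrs_def switch_def doubleton_eq_iff)
      then show ?thesis using deg[OF w] by simp
    qed
  qed
  moreover have "?E \<subseteq> edges_on V"
    using E V ne by (auto simp: switch_def doubleton_in_edges_on)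
  ultimately show ?thesis by (simp add: regular_edge_sets_def)
qed

text \<open>
  Every graph containing \<open>uv\<close> has almost \<open>d * card V\<close> switchings that destroy \<open>uv\<close>, whereas a graph
  arises in at most \<open>d\<^sup>2\<close> ways, since \<open>x\<close> and \<open>y\<close> become neighbours of \<open>u\<close> and \<open>v\<close>.
\<close>
lemma switching_bound:
  assumes V: "finite V" and F: "F \<subseteq> edges_on V" and uvF: "{u, v} \<notin> F"
  shows "card {E \<in> regular_edge_sets V d. insert {u, v} F \<subseteq> E} *
      (d * card V - (2 * (card F + 1) + 2 * (d * (d + 1))))
    \<le> d\<^sup>2 * card {E \<in> regular_edge_sets V d. F \<subseteq> E}"
    (is "card ?N' * ?L \<le> _ * card ?N")
proof -
  \<comment> \<open>The admissible choices for a switching. As \<open>xy\<close> is kept out of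
    \<open>F\<close> and \<open>uv\<close> is not in \<open>F\<close>, the switched graph still
    contains \<open>F\<close>.\<close>
  define X where "X E = {(x, y). {x, y} \<in> E \<and> {x, y} \<notin> insert {u, v} F \<and>
      x \<notin> insert u (nbrs E u) \<and> y \<notin> insert v (nbrs E v)}" for E
  let ?h = "\<lambda>(E, x, y). (switch u v E x y, x, y)"
  have finF: "finite F" using F V finite_edges_on finite_subset by blast
  have finR: "finite (regular_edge_sets V d)" using V by (rule finite_regular_edge_sets)
  have X: "finite (X E) \<and> ?L \<le> card (X E)" if "E \<in> ?N'" for E
  proof -
    have E: "E \<subseteq> edges_on V" and deg: "\<And>w. w \<in> V \<Longrightarrow> card (nbrs E w) = d"
      and uv: "{u, v} \<in> E"
      using that by (auto simp: regular_edge_sets_def)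
    have uvV: "u \<in> V" "v \<in> V" using edge_memD[OF E uv] by auto
    have fin: "finite (nbrs E w)" for w
      using finite_subset[OF nbrs_subset[OF E] V] .
    let ?P = "{(x, y). {x, y} \<in> E}"
    let ?S = "\<lambda>w. Sigma (insert w (nbrs E w)) (nbrs E)"
    have finP: "finite ?P"
      by (rule card_ordered_pairs_le(1)[OF finite_subset[OF E finite_edges_on[OF V]]])
    have P: "?P = Sigma V (nbrs E)"
      by (auto simp: nbrs_def dest: edge_memD[OF E])
    have cardP: "card ?P = d * card V"
      unfolding P using deg V fin by (simp add: card_SigmaI)
    have XP: "finite (X E)"
      by (rule finite_subset[OF _ finP]) (auto simp: X_def)
    have S: "finite (?S w) \<and> card (?S w) \<le> d * (d + 1)" if "w \<in> V" for w
    proof -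
      have "card (?S w) \<le> card (insert w (nbrs E w)) * d"
        using that fin nbrs_subset[OF E] deg by (intro card_Sigma_le) (auto simp: subset_iff)
      also have "card (insert w (nbrs E w)) \<le> d + 1"
        using deg[OF that] card_insert_le_m1[of "d + 1" "nbrs E w" w] by simp
      finally show ?thesis using fin by (simp add: mult.commute)
    qed
    \<comment> \<open>An ordered edge \<open>(x, y)\<close> is inadmissible only if it is
      \<open>uv\<close> or in \<open>F\<close>, or starts in the closed neighbourhood of
      \<open>u\<close>, or ends in that of \<open>v\<close>. Each of the last two excludes at most
      \<open>d * (d + 1)\<close> pairs.\<close>
    have "?P \<subseteq> X E \<union> {(x, y). {x, y} \<in> insert {u, v} F} \<union> (?S u \<union> prod.swap ` ?S v)"
    proof
      fix p assume p: "p \<in> ?P"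
      obtain x y where [simp]: "p = (x, y)" by (cases p)
      have "y \<in> nbrs E x" "x \<in> nbrs E y" using p by (auto simp: nbrs_def insert_commute)
      then have "x \<in> insert u (nbrs E u) \<Longrightarrow> p \<in> ?S u"
        and "y \<in> insert v (nbrs E v) \<Longrightarrow> p \<in> prod.swap ` ?S v"
        by (auto intro!: image_eqI[of _ _ "(y, x)"])
      then show "p \<in> X E \<union> {(x, y). {x, y} \<in> insert {u, v} F} \<union> (?S u \<union> prod.swap ` ?S v)"
        using p by (auto simp: X_def)
    qed
    then have "card ?P \<le> card (X E \<union> {(x, y). {x, y} \<in> insert {u, v} F} \<union>
        (?S u \<union> prod.swap ` ?S v))"
      using XP S uvV card_ordered_pairs_le(1)[of "insert {u, v} F"] finF
      by (intro card_mono) (auto)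
    also have "\<dots> \<le> (card (X E) + card {(x, y). {x, y} \<in> insert {u, v} F}) +
        (card (?S u) + card (prod.swap ` ?S v))"
      by (intro order.trans[OF card_Un_le] add_mono card_Un_le)
    also have "card (prod.swap ` ?S v) = card (?S v)"
      by (rule card_image) simp
    also have "card {(x, y). {x, y} \<in> insert {u, v} F} \<le> 2 * (card F + 1)"
      using card_ordered_pairs_le(2)[of "insert {u, v} F"] finF uvF by simp
    finally have "card ?P \<le> card (X E) + 2 * (card F + 1) + (card (?S u) + card (?S v))"
      by simp
    moreover have "card (?S u) + card (?S v) \<le> 2 * (d * (d + 1))"
      using S[of u] S[of v] uvV by linarith
    ultimately show ?thesis using cardP XP by linarith
  qed
  have Nfin: "finite ?N'" "finite ?N" using finR by auto
  have "card ?N' * ?L \<le> card (Sigma ?N' X)"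
    using Nfin X by (intro card_Sigma_ge)
  also have "\<dots> \<le> card (Sigma ?N (\<lambda>E. nbrs E u \<times> nbrs E v))"
  proof (rule card_inj_on_le[of ?h])
    \<comment> \<open>A switching can be undone once \<open>x\<close> and \<open>y\<close> are
      known, so recording them makes \<open>?h\<close> injective.\<close>
    have inv: "E = (switch u v E x y - {{u, x}, {v, y}}) \<union> {{u, v}, {x, y}}"
      if "E \<in> ?N'" "(x, y) \<in> X E" for E x y
      using that by (auto simp: switch_def X_def nbrs_def)
    show "inj_on ?h (Sigma ?N' X)"
    proof (rule inj_onI)
      fix p q assume p: "p \<in> Sigma ?N' X" "q \<in> Sigma ?N' X" and eq: "?h p = ?h q"
      obtain E x y where [simp]: "p = (E, x, y)" by (cases p) auto
      obtain E' x' y' where [simp]: "q = (E', x', y')" by (cases q) auto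
      have xy: "x' = x" "y' = y" "switch u v E x y = switch u v E' x y" using eq by auto
      have "E = (switch u v E x y - {{u, x}, {v, y}}) \<union> {{u, v}, {x, y}}"
        by (rule inv) (use p in auto)
      also have "\<dots> = (switch u v E' x y - {{u, x}, {v, y}}) \<union> {{u, v}, {x, y}}"
        using xy by simp
      also have "\<dots> = E'"
        by (rule inv[symmetric]) (use p xy in auto)
      finally show "p = q" using xy by simp
    qed
    show "?h ` Sigma ?N' X \<subseteq> Sigma ?N (\<lambda>E. nbrs E u \<times> nbrs E v)"
    proof
      fix q assume "q \<in> ?h ` Sigma ?N' X"
      then obtain E x y where q: "q = (switch u v E x y, x, y)"
        and E: "E \<in> regular_edge_sets V d" "insert {u, v} F \<subseteq> E" and xy: "(x, y) \<in> X E"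
        by auto
      have "switch u v E x y \<in> regular_edge_sets V d"
        using E xy V by (intro switch_regular) (auto simp: X_def)
      moreover have "F \<subseteq> switch u v E x y"
        using E xy uvF by (auto simp: switch_def X_def)
      ultimately show "q \<in> Sigma ?N (\<lambda>E. nbrs E u \<times> nbrs E v)"
        unfolding q by (simp add: mem_nbrs) (simp add: switch_def)
    qed
    show "finite (Sigma ?N (\<lambda>E. nbrs E u \<times> nbrs E v))"
      using Nfin V by (auto intro!: finite_SigmaI finite_subset[OF nbrs_subset] 
          simp: regular_edge_sets_def)
  qed
  also have "\<dots> \<le> card ?N * d\<^sup>2"
  proof (cases "u \<in> V \<and> v \<in> V")
    case True
    show ?thesis
    proof (intro card_Sigma_le Nfin conjI)
      fix E assume "E \<in> ?N"
      then have E: "E \<subseteq> edges_on V" and deg: "\<And>w. w \<in> V \<Longrightarrow> card (nbrs E w) = d"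
        by (auto simp: regular_edge_sets_def)
      show "finite (nbrs E u \<times> nbrs E v)"
        using finite_subset[OF nbrs_subset[OF E] V] by blast
      show "card (nbrs E u \<times> nbrs E v) \<le> d\<^sup>2"
        using deg True by (simp add: card_cartesian_product power2_eq_square)
    qed
  next
    \<comment> \<open>Only vertices of \<open>V\<close> are known to have degree \<open>d\<close>,
      but all edges stay inside \<open>V\<close>, so one of the two neighbourhoods is empty.\<close>
    case False
    then have "nbrs E u \<times> nbrs E v = {}" if "E \<in> ?N" for E
      using that by (fastforce simp: regular_edge_sets_def nbrs_def doubleton_in_edges_on)
    then have "Sigma ?N (\<lambda>E. nbrs E u \<times> nbrs E v) = {}" by blast
    then show ?thesis by simp
  qed
  finally show ?thesis by (simp add: mult.commute)
qed

text \<open>The edges of \<open>F\<close> are added one at a time by \<open>switching_bound\<close>.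
  The assumption \<open>small\<close> keeps the subtracted term at most half of
  \<open>d * card V\<close>, so each edge costs a factor of at most
  \<open>d\<^sup>2 / (d * card V / 2)\<close>.\<close>

lemma card_regular_edge_sets_containing_le:
  assumes V: "finite V" "V \<noteq> {}" and F: "F \<subseteq> edges_on V"
    and small: "4 * card F + 4 * (d * (d + 1)) \<le> d * card V" and d: "d > 0"
  shows "real (card {E \<in> regular_edge_sets V d. F \<subseteq> E})
    \<le> (2 * real d / real (card V)) ^ card F * real (card (regular_edge_sets V d))"
proof -
  have "finite F" using F V finite_edges_on finite_subset by blast
  then show ?thesis using F small
  proof (induction F rule: finite_induct)
    case empty
    then show ?case by simp
  next
    case (insert e F)
    obtain u v where e: "e = {u, v}" using insert.prems by (auto elim: edges_onE)
    let ?N = "\<lambda>F. real (card {E \<in> regular_edge_sets V d. F \<subseteq> E})"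
    have n: "real (card V) > 0" using V by (simp add: card_gt_0_iff)
    have "d * card V \<le> 2 * (d * card V - (2 * (card F + 1) + 2 * (d * (d + 1))))"
      (is "_ \<le> 2 * ?L") using insert.prems(2) insert.hyps by simp
    then have "real d * real (card V) \<le> 2 * real ?L"
      by (metis of_nat_le_iff of_nat_mult of_nat_numeral)
    then have "?N (insert e F) * (real d * real (card V)) \<le> ?N (insert e F) * (2 * real ?L)"
      by (rule mult_left_mono) simp
    also have "\<dots> = 2 * real (card {E \<in> regular_edge_sets V d. insert e F \<subseteq> E} * ?L)"
      by simp
    also have "\<dots> \<le> 2 * real (d\<^sup>2 * card {E \<in> regular_edge_sets V d. F \<subseteq> E})"
      using switching_bound[of V F u v d] V insert.prems insert.hyps
      unfolding e by (intro mult_left_mono of_nat_mono) auto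
    finally have "?N (insert e F) * (real d * real (card V)) \<le> 2 * (real d)\<^sup>2 * ?N F"
      by simp
    then have "?N (insert e F) \<le> (2 * real d / real (card V)) * ?N F"
      using n d by (simp add: field_simps power2_eq_square)
    also have "\<dots> \<le> (2 * real d / real (card V)) *
        ((2 * real d / real (card V)) ^ card F * real (card (regular_edge_sets V d)))"
      using insert by (intro mult_left_mono insert.IH) auto
    finally show ?case using insert.hyps by simp
  qed
qed

section \<open>Moved copies of edge sets\<close>

text \<open>The map may be any self-map of \<open>V\<close>, since extending a partial isomorphism
  by the identity can destroy injectivity. Taking it extensional leaves only
  \<open>card V ^ card V\<close> maps, and injectivity on \<open>S\<close> with disjointness ensures
  that \<open>2 * k\<close> distinct edges are present.\<close>

definition has_moved_copy :: "'a set \<Rightarrow> nat \<Rightarrow> 'a set set \<Rightarrow> bool" where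
  "has_moved_copy V k E \<longleftrightarrow> (\<exists>g \<in> V \<rightarrow>\<^sub>E V. \<exists>S \<subseteq> E. card S = k \<and>
    (`) g ` S \<subseteq> E \<and> (`) g ` S \<inter> S = {} \<and> inj_on ((`) g) S)"

text \<open>\<open>n ^ n / fact n\<close> is a single term of the exponential series for
  \<open>exp n\<close>, and \<open>exp 1\<close> is at most 3.\<close>

lemma power_div_3_le_fact: "(real n / 3) ^ n \<le> fact n"
proof -
  have "inverse (fact n) * real n ^ n \<le> (\<Sum>k. inverse (fact k) * real n ^ k)"
    using sum_le_suminf[OF summable_exp[of "real n"], of "{n}"] by simp
  also have "\<dots> = exp (real n)"
    by (simp add: exp_def)
  also have "\<dots> = exp 1 ^ n" by (simp add: exp_of_nat_mult[symmetric])
  also have "\<dots> \<le> 3 ^ n" by (intro power_mono exp_le) simp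
  finally show ?thesis by (simp add: field_simps)
qed

text \<open>A union bound over the pairs of a map and a set of \<open>k\<close> edges: for each pair
  the graph must contain \<open>2 * k\<close> prescribed edges.\<close>

lemma card_has_moved_copy_le:
  assumes V: "finite V" "V \<noteq> {}" and d: "d > 0"
    and small: "8 * k + 4 * (d * (d + 1)) \<le> d * card V"
  shows "real (card {E \<in> regular_edge_sets V d. has_moved_copy V k E})
    \<le> real (card V ^ card V * (card (edges_on V) choose k)) *
      ((2 * real d / real (card V)) ^ (2 * k) * real (card (regular_edge_sets V d)))"
proof -
  let ?R = "regular_edge_sets V d" and ?D = "edges_on V"
  define I where "I = {(g, S). g \<in> V \<rightarrow>\<^sub>E V \<and> S \<subseteq> ?D \<and> card S = k \<and>
    (`) g ` S \<subseteq> ?D \<and> (`) g ` S \<inter> S = {} \<and> inj_on ((`) g) S}"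
  let ?N = "\<lambda>(g, S). {E \<in> ?R. S \<union> (`) g ` S \<subseteq> E}"
  have finR: "finite ?R" and finD: "finite ?D"
    using V by (auto intro: finite_regular_edge_sets finite_edges_on)
  have finPiE: "finite (V \<rightarrow>\<^sub>E V)" using V by (intro finite_PiE)
  have finS: "finite {S. S \<subseteq> ?D \<and> card S = k}" using finD by simp
  have I: "I \<subseteq> (V \<rightarrow>\<^sub>E V) \<times> {S. S \<subseteq> ?D \<and> card S = k}" by (auto simp: I_def)
  then have finI: "finite I" using finPiE finS by (meson finite_SigmaI finite_subset)
  have "card I \<le> card ((V \<rightarrow>\<^sub>E V) \<times> {S. S \<subseteq> ?D \<and> card S = k})"
    using I finPiE finS by (intro card_mono) auto
  also have "\<dots> = card V ^ card V * (card ?D choose k)"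
    using V finD by (simp add: card_cartesian_product card_funcsetE n_subsets)
  finally have cardI: "card I \<le> card V ^ card V * (card ?D choose k)" .
  have "{E \<in> ?R. has_moved_copy V k E} \<subseteq> (\<Union>p\<in>I. ?N p)"
  proof
    fix E assume "E \<in> {E \<in> ?R. has_moved_copy V k E}"
    then obtain g S where E: "E \<in> ?R" "E \<subseteq> ?D" and g: "g \<in> V \<rightarrow>\<^sub>E V" "S \<subseteq> E" "card S = k"
      "(`) g ` S \<subseteq> E" "(`) g ` S \<inter> S = {}" "inj_on ((`) g) S"
      by (auto simp: has_moved_copy_def regular_edge_sets_def)
    then have "(g, S) \<in> I" by (auto simp: I_def)
    then show "E \<in> (\<Union>p\<in>I. ?N p)" using E g by (intro UN_I[of "(g, S)"]) auto
  qed
  then have "card {E \<in> ?R. has_moved_copy V k E} \<le> card (\<Union>p\<in>I. ?N p)"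
    using finI finR by (intro card_mono) auto
  also have "\<dots> \<le> (\<Sum>p\<in>I. card (?N p))" by (rule card_UN_le[OF finI])
  finally have "real (card {E \<in> ?R. has_moved_copy V k E}) \<le> real (\<Sum>p\<in>I. card (?N p))"
    by (rule of_nat_mono)
  also have "\<dots> = (\<Sum>p\<in>I. real (card (?N p)))" by simp
  also have "\<dots> \<le> (\<Sum>p\<in>I. (2 * real d / real (card V)) ^ (2 * k) * real (card ?R))"
  proof (rule sum_mono)
    fix p assume "p \<in> I"
    then obtain g S where p: "p = (g, S)" and S: "S \<subseteq> ?D" "card S = k"
      "(`) g ` S \<subseteq> ?D" "(`) g ` S \<inter> S = {}" "inj_on ((`) g) S"
      by (auto simp: I_def)
    have "finite S" using S finD finite_subset by blast
    then have card: "card (S \<union> (`) g ` S) = 2 * k"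
      using S card_Un_disjoint[of S "(`) g ` S"] by (simp add: card_image Int_commute)
    have "4 * card (S \<union> (`) g ` S) + 4 * (d * (d + 1)) \<le> d * card V"
      using small unfolding card by simp
    from card_regular_edge_sets_containing_le[OF V _ this d] S
    show "real (card (?N p)) \<le> (2 * real d / real (card V)) ^ (2 * k) * real (card ?R)"
      unfolding p card by simp
  qed
  also have "\<dots> = real (card I) * ((2 * real d / real (card V)) ^ (2 * k) * real (card ?R))"
    by simp
  also have "\<dots> \<le> real (card V ^ card V * (card ?D choose k)) *
      ((2 * real d / real (card V)) ^ (2 * k) * real (card ?R))"
    using cardI by (intro mult_right_mono of_nat_mono) auto
  finally show ?thesis .
qed

text \<open>
  The \<open>n ^ n\<close> maps and about \<open>n ^ k\<close> edge sets are beaten by the probability \<open>O(1 / n) ^ (2 * k)\<close>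
  of containing an edge set and its disjoint image as soon as \<open>k > n\<close>.
\<close>
lemma card_has_moved_copy_le_half_power:
  assumes V: "finite V" and d: "d \<ge> 32" and n: "card V \<ge> 72 * d ^ 4"
  shows "real (card {E \<in> regular_edge_sets V d. has_moved_copy V (2 * card V) E})
    \<le> (1 / 2) ^ card V * real (card (regular_edge_sets V d))"
proof -
  define n where "n = card V"
  have "d ^ 4 \<ge> d ^ 2" using d by (intro power_increasing) auto
  then have nd: "n \<ge> 72 * (d * d)" using assms(3) by (simp add: n_def power2_eq_square)
  have "d + 1 \<le> d * 2" using d by simp
  also have "\<dots> \<le> d * d" using d by (intro mult_le_mono2) simp
  finally have "8 * (d + 1) \<le> 72 * (d * d)" by (intro mult_le_mono) simp_all
  then have n8: "n \<ge> 8 * (d + 1)" using nd by (rule order.trans)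
  have n0: "n > 0" using n8 by simp
  then have V': "V \<noteq> {}" by (auto simp: n_def)
  \<comment> \<open>The edge sets in question have \<open>4 * n\<close> elements. Their contribution
    \<open>16 * n\<close> takes at most half of \<open>d * n\<close> because \<open>d\<close> is at
    least 32, and \<open>4 * (d * (d + 1))\<close> takes at most the other half because
    \<open>n\<close> is large.\<close>
  have "32 * n \<le> d * n" using d by (intro mult_le_mono1)
  moreover have "d * (8 * (d + 1)) \<le> d * n" using n8 by (intro mult_le_mono2)
  moreover have "2 * (8 * (2 * n) + 4 * (d * (d + 1))) = 32 * n + d * (8 * (d + 1))"
    by (simp add: algebra_simps)
  ultimately have small: "8 * (2 * n) + 4 * (d * (d + 1)) \<le> d * n" by linarith
  \<comment> \<open>With at most \<open>n\<^sup>2\<close> possible edges and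
    \<open>fact (2 * n)\<close> at least \<open>(2 * n / 3) ^ (2 * n)\<close>, the number of edge
    sets is at most \<open>(3 * n / 2) ^ (2 * n)\<close>.\<close>
  have "(card (edges_on V) choose (2 * n)) * fact (2 * n) \<le> card (edges_on V) ^ (2 * n)"
    by (rule binomial_fact_pow)
  also have "\<dots> \<le> (n\<^sup>2) ^ (2 * n)"
    using card_edges_on_le[OF V] by (intro power_mono) (auto simp: n_def)
  finally have "real ((card (edges_on V) choose (2 * n)) * fact (2 * n)) \<le> real ((n\<^sup>2) ^ (2 * n))"
    by (rule of_nat_mono)
  then have "real (card (edges_on V) choose (2 * n)) * fact (2 * n) \<le> (real n ^ 2) ^ (2 * n)"
    by simp
  moreover have "real (card (edges_on V) choose (2 * n)) * (real (2 * n) / 3) ^ (2 * n)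
      \<le> real (card (edges_on V) choose (2 * n)) * fact (2 * n)"
    by (intro mult_left_mono power_div_3_le_fact) auto
  ultimately have "real (card (edges_on V) choose (2 * n)) * (real (2 * n) / 3) ^ (2 * n)
      \<le> (real n ^ 2) ^ (2 * n)" by linarith
  then have "real (card (edges_on V) choose (2 * n))
      \<le> (real n ^ 2) ^ (2 * n) / (real (2 * n) / 3) ^ (2 * n)"
    using n0 by (simp add: pos_le_divide_eq)
  also have "\<dots> = (real n ^ 2 / (real (2 * n) / 3)) ^ (2 * n)"
    by (simp add: power_divide)
  also have "real n ^ 2 / (real (2 * n) / 3) = 3 * real n / 2"
    using n0 by (simp add: field_simps power2_eq_square)
  finally have choose: "real (card (edges_on V) choose (2 * n)) \<le> (3 * real n / 2) ^ (2 * n)" .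
  have "real (card {E \<in> regular_edge_sets V d. has_moved_copy V (2 * n) E})
    \<le> real (n ^ n * (card (edges_on V) choose (2 * n))) *
      ((2 * real d / real n) ^ (2 * (2 * n)) * real (card (regular_edge_sets V d)))"
    using card_has_moved_copy_le[OF V V', of d "2 * n"] small d by (simp add: n_def)
  also have "\<dots> \<le> (real n ^ n * (3 * real n / 2) ^ (2 * n)) *
      ((2 * real d / real n) ^ (2 * (2 * n)) * real (card (regular_edge_sets V d)))"
    using choose by (intro mult_right_mono) (auto intro!: mult_left_mono)
  also have "\<dots> = (real n * (3 * real n / 2) ^ 2 * (2 * real d / real n) ^ 4) ^ n *
      real (card (regular_edge_sets V d))"
    by (simp add: power_mult_distrib power_mult mult.assoc flip: power_mult)
  \<comment> \<open>The powers of \<open>n\<close> are 1 from the maps, 2 from the edge sets and -4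
    from the probability. One factor \<open>1 / n\<close> survives, and \<open>72 * d ^ 4\<close> is
    the threshold that makes the base at most \<open>1 / 2\<close>.\<close>
  also have "real n * (3 * real n / 2) ^ 2 * (2 * real d / real n) ^ 4 = 36 * real d ^ 4 / real n"
    using n0 by (simp add: field_simps eval_nat_numeral)
  also have "(36 * real d ^ 4 / real n) ^ n * real (card (regular_edge_sets V d))
      \<le> (1 / 2) ^ n * real (card (regular_edge_sets V d))"
  proof (intro mult_right_mono power_mono)
    have "real (72 * d ^ 4) \<le> real n" using n unfolding n_def by (rule of_nat_mono)
    then show "36 * real d ^ 4 / real n \<le> 1 / 2" using n0 by (simp add: field_simps)
  qed auto
  finally show ?thesis by (simp add: n_def)
qed

section \<open>From many moved vertices to a moved copy\<close>

lemma obtain_subset_disjoint_from_image: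
  assumes N: "finite N" and inj: "inj_on \<phi> N" and moved: "\<And>x. x \<in> N \<Longrightarrow> \<phi> x \<noteq> x"
  obtains S where "S \<subseteq> N" "\<phi> ` S \<inter> S = {}" "card N \<le> 3 * card S"
proof -
  let ?P = "\<lambda>S. S \<subseteq> N \<and> \<phi> ` S \<inter> S = {}"
  have "\<forall>S. ?P S \<longrightarrow> card S < card N + 1"
    using card_mono[OF N] by (auto intro: le_imp_less_Suc)
  then obtain S where S: "?P S" and max: "\<And>T. ?P T \<Longrightarrow> card T \<le> card S"
    using ex_has_greatest_nat[of ?P "{}" card "card N + 1"] by auto
  have finS: "finite S" using S N finite_subset by blast
  \<comment> \<open>\<open>S\<close> is maximal among the subsets disjoint from their image. An
    element outside the three sets could be added to it, as \<phi> has no fixed point in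
    \<open>N\<close>; by injectivity each of the three has at most \<open>card S\<close>
    elements.\<close>
  have "N \<subseteq> S \<union> \<phi> ` S \<union> {x \<in> N. \<phi> x \<in> S}"
  proof (rule ccontr)
    assume "\<not> ?thesis"
    then obtain x where x: "x \<in> N" "x \<notin> S" "x \<notin> \<phi> ` S" "\<phi> x \<notin> S" by auto
    then have "?P (insert x S)" using S moved[of x] by auto
    then show False using max[of "insert x S"] x finS by simp
  qed
  then have "card N \<le> card (S \<union> \<phi> ` S \<union> {x \<in> N. \<phi> x \<in> S})"
    using N finS by (intro card_mono) auto
  also have "\<dots> \<le> card S + card (\<phi> ` S) + card {x \<in> N. \<phi> x \<in> S}"
    by (intro order.trans[OF card_Un_le] add_mono card_Un_le order.refl)
  also have "card (\<phi> ` S) \<le> card S" by (rule card_image_le[OF finS])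
  also have "card {x \<in> N. \<phi> x \<in> S} \<le> card S"
    using inj finS by (intro card_inj_on_le[of \<phi>]) (auto intro: inj_on_subset)
  finally have "card N \<le> 3 * card S" by simp
  then show ?thesis using S that by blast
qed

text \<open>Let \<open>n\<close> be \<open>card V\<close>. If \<delta> n vertices moved, at least
  \<delta> n / 2 of them would have \<open>K\<close> neighbours in \<open>U\<close>. As
  \<open>K\<close> \<delta> is at least 28, this gives \<open>14 * n\<close> ordered pairs, hence
  \<open>7 * n\<close> edges inside \<open>U\<close> with a moved end. At most \<open>n\<close> of
  them are fixed as sets, and a third of the other \<open>6 * n\<close> can be chosen disjoint from
  its image: the \<open>2 * n\<close> edges of a moved copy.\<close>

lemma few_moved_vertices:
  fixes \<delta> :: real
  assumes V: "finite V" and E: "E \<subseteq> edges_on V" and not: "\<not> has_moved_copy V (2 * card V) E"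
    and U: "U \<subseteq> V" and low: "real (card {v \<in> V. card (nbrs E v \<inter> U) < K}) \<le> \<delta> / 2 * card V"
    and f: "f \<in> U \<rightarrow> V" "inj_on f U" "\<And>u v. {u, v} \<in> E \<Longrightarrow> u \<in> U \<Longrightarrow> v \<in> U \<Longrightarrow> {f u, f v} \<in> E"
    and K: "28 \<le> real K * \<delta>" and V0: "V \<noteq> {}"
  shows "real (card {u \<in> U. f u \<noteq> u}) < \<delta> * card V"
proof (rule ccontr)
  assume "\<not> ?thesis"
  then have M: "\<delta> * card V \<le> real (card {u \<in> U. f u \<noteq> u})" by simp
  define n where "n = card V"
  have n0: "n > 0" using V V0 by (simp add: n_def card_gt_0_iff)
  define B where "B = {u \<in> U. f u \<noteq> u \<and> K \<le> card (nbrs E u \<inter> U)}"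
  define EM where "EM = {e \<in> E. e \<subseteq> U \<and> (\<exists>u\<in>e. f u \<noteq> u)}"
  define N where "N = {e \<in> EM. f ` e \<noteq> e}"
  have finU: "finite U" using U V finite_subset by blast
  have finE: "finite E" using E finite_edges_on[OF V] finite_subset by blast
  have finEM: "finite EM" and finN: "finite N" and finB: "finite B"
    using finE finU by (auto simp: EM_def N_def B_def)
  have "card {u \<in> U. f u \<noteq> u} \<le> card (B \<union> {v \<in> V. card (nbrs E v \<inter> U) < K})"
    using finB V U by (intro card_mono) (auto simp: B_def)
  also have "\<dots> \<le> card B + card {v \<in> V. card (nbrs E v \<inter> U) < K}" by (rule card_Un_le)
  finally have B: "\<delta> / 2 * n \<le> real (card B)"
    using M low by (simp add: n_def)
  have "card B * K \<le> card (Sigma B (\<lambda>u. nbrs E u \<inter> U))"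
    using finB finU by (intro card_Sigma_ge) (auto simp: B_def)
  also have "\<dots> \<le> card {(x, y). {x, y} \<in> EM}"
    using finEM by (intro card_mono card_ordered_pairs_le(1)) (auto simp: B_def EM_def mem_nbrs)
  also have "\<dots> \<le> 2 * card EM" by (rule card_ordered_pairs_le(2)[OF finEM])
  finally have "real (card B * K) \<le> real (2 * card EM)" by (rule of_nat_mono)
  then have BK: "real (card B) * real K \<le> 2 * real (card EM)"
    by (simp only: of_nat_mult of_nat_numeral)
  have "28 * real n \<le> (real K * \<delta>) * real n" by (intro mult_right_mono K) simp
  also have "\<dots> = 2 * ((\<delta> / 2 * n) * real K)" by simp
  also have "\<dots> \<le> 2 * (real (card B) * real K)"
    using B by (intro mult_left_mono mult_right_mono) auto
  also have "\<dots> \<le> 4 * real (card EM)" using BK by linarith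
  finally have EM: "7 * n \<le> card EM" by linarith
  \<comment> \<open>An edge that is fixed although an endpoint \<open>u\<close> moves is swapped by \<open>f\<close>, so \<open>u\<close> determines it.\<close>
  have "EM - N \<subseteq> (\<lambda>u. {u, f u}) ` U"
  proof
    fix e assume e: "e \<in> EM - N"
    then obtain u where u: "u \<in> e" "f u \<noteq> u" "e \<subseteq> U" "f ` e = e" "e \<in> edges_on V"
      using E by (auto simp: EM_def N_def)
    then obtain w where "e = {u, w}" by (auto simp: edges_on_def card_2_iff)
    moreover have "f u \<in> e" using u by blast
    ultimately have "e = {u, f u}" using u by auto
    then show "e \<in> (\<lambda>u. {u, f u}) ` U" using u by blast
  qed
  then have "card (EM - N) \<le> card U" using finU by (rule surj_card_le[rotated])
  also have "\<dots> \<le> n" unfolding n_def using U V by (intro card_mono)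
  finally have "card EM \<le> card N + n"
    using diff_card_le_card_Diff[OF finN, of EM] by linarith
  then have cardN: "6 * n \<le> card N" using EM by linarith
  have NU: "N \<subseteq> Pow U" by (auto simp: N_def EM_def)
  have injN: "inj_on ((`) f) N" by (rule inj_on_subset[OF inj_on_image_Pow[OF f(2)] NU])
  have moved: "f ` e \<noteq> e" if "e \<in> N" for e using that by (simp add: N_def)
  obtain S where S: "S \<subseteq> N" "(`) f ` S \<inter> S = {}" "card N \<le> 3 * card S"
    using obtain_subset_disjoint_from_image[OF finN injN moved] .
  have "2 * n \<le> card S" using S cardN by linarith
  then obtain T where T: "T \<subseteq> S" "card T = 2 * n" using obtain_subset_with_card_n by metis
  \<comment> \<open>Off \<open>U\<close> any values in \<open>V\<close> would do: the edges of
    \<open>T\<close> lie inside \<open>U\<close>, so \<open>g\<close> and \<open>f\<close> act on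
    them alike.\<close>
  define g where "g = restrict (\<lambda>v. if v \<in> U then f v else v) V"
  have gf: "g ` e = f ` e" if "e \<in> T" for e
  proof (rule image_cong[OF refl])
    fix v assume "v \<in> e"
    then have "v \<in> U" using that T S NU by blast
    then show "g v = f v" using U by (auto simp: g_def)
  qed
  have g: "g \<in> V \<rightarrow>\<^sub>E V" using f(1) by (auto simp: g_def)
  have TE: "T \<subseteq> E" using T S by (auto simp: N_def EM_def)
  have "(`) f ` T \<subseteq> E"
  proof clarify
    fix e assume e: "e \<in> T"
    then have eU: "e \<subseteq> U" "e \<in> E" using T S TE by (auto simp: N_def EM_def)
    then obtain u v where "e = {u, v}" using E by (blast elim: edges_onE)
    then show "f ` e \<in> E" using f(3)[of u v] eU by simp
  qed
  moreover have "(`) f ` T \<inter> T = {}" using S T by blast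
  moreover have "inj_on ((`) f) T"
    by (rule inj_on_subset[OF injN]) (use S T in blast)
  moreover have "(`) g ` T = (`) f ` T" by (rule image_cong[OF refl gf])
  moreover have "inj_on ((`) g) T \<longleftrightarrow> inj_on ((`) f) T" by (rule inj_on_cong[OF gf])
  ultimately have "has_moved_copy V (2 * n) E"
    unfolding has_moved_copy_def using g TE T by (intro bexI[of _ g] exI[of _ T]) auto
  then show False using not by (simp add: n_def)
qed

section \<open>Typical vertex sets\<close>

lemma sum_power_card_Pow:
  fixes x :: real
  assumes "finite D"
  shows "(\<Sum>X\<in>Pow D. x ^ card X) = (1 + x) ^ card D"
  using prod_add[OF assms, of "\<lambda>_. x" "\<lambda>_. 1"] by (simp add: add.commute)

text \<open>Markov's inequality for the weight \<open>x ^ card X\<close>.\<close>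
lemma card_small_subsets_le:
  fixes x m :: real
  assumes "finite D" "0 < x" "x \<le> 1"
  shows "real (card {X. X \<subseteq> D \<and> real (card X) \<le> m}) * x powr m \<le> (1 + x) ^ card D"
proof -
  have "real (card {X. X \<subseteq> D \<and> real (card X) \<le> m}) * x powr m
      = (\<Sum>X | X \<subseteq> D \<and> real (card X) \<le> m. x powr m)" by simp
  also have "\<dots> \<le> (\<Sum>X | X \<subseteq> D \<and> real (card X) \<le> m. x ^ card X)"
    using assms by (intro sum_mono) (auto simp: powr_mono' simp flip: powr_realpow)
  also have "\<dots> \<le> (\<Sum>X\<in>Pow D. x ^ card X)"
    using assms by (intro sum_mono2) auto
  finally show ?thesis using sum_power_card_Pow[OF assms(1)] by simp
qed

text \<open>\<open>U\<close> is determined by its trace on \<open>D\<close> and by a free choice off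
  \<open>D\<close>. Weight \<open>1 / 2\<close> in \<open>card_small_subsets_le\<close> bounds the
  number of traces by \<open>(3 / 2) ^ card D * 2 ^ K\<close>, against \<open>2 ^ card D\<close>
  traces in all.\<close>

lemma card_sets_meeting_in_few_le:
  assumes V: "finite V" and D: "D \<subseteq> V"
  shows "real (card {U \<in> Pow V. card (D \<inter> U) < K}) \<le> 2 ^ card V * ((3 / 4) ^ card D * 2 ^ K)"
proof -
  let ?A = "{X. X \<subseteq> D \<and> real (card X) \<le> real K}"
  have finD: "finite D" using D V by (rule finite_subset)
  have "card {U \<in> Pow V. card (D \<inter> U) < K} \<le> card (?A \<times> Pow (V - D))"
  proof (rule card_inj_on_le[of "\<lambda>U. (D \<inter> U, U - D)"])
    show "inj_on (\<lambda>U. (D \<inter> U, U - D)) {U \<in> Pow V. card (D \<inter> U) < K}"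
      by (rule inj_onI) blast
  qed (use V finD in auto)
  also have "\<dots> = card ?A * 2 ^ (card V - card D)"
    using V D finD by (simp add: card_cartesian_product card_Pow card_Diff_subset)
  finally have "real (card {U \<in> Pow V. card (D \<inter> U) < K}) \<le> real (card ?A * 2 ^ (card V - card D))"
    by (rule of_nat_mono)
  also have "\<dots> = real (card ?A) * 2 ^ (card V - card D)" by simp
  also have "\<dots> \<le> ((3 / 2) ^ card D * 2 ^ K) * 2 ^ (card V - card D)"
  proof (rule mult_right_mono)
    have "real (card ?A) * (1 / 2) powr real K \<le> (1 + 1 / 2) ^ card D"
      by (rule card_small_subsets_le) (use finD in auto)
    then show "real (card ?A) \<le> (3 / 2) ^ card D * 2 ^ K"
      by (simp add: powr_realpow power_divide field_simps)
  qed simp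
  also have "\<dots> = 2 ^ card V * ((3 / 4) ^ card D * 2 ^ K)"
  proof -
    have "(2::real) ^ card V = 2 ^ card D * 2 ^ (card V - card D)"
      using card_mono[OF V D] by (simp flip: power_add)
    moreover have "((3::real) / 2) ^ card D = 2 ^ card D * (3 / 4) ^ card D"
      by (simp flip: power_mult_distrib)
    ultimately show ?thesis by simp
  qed
  finally show ?thesis .
qed

text \<open>Markov's inequality: a given vertex has fewer than \<open>K\<close> neighbours in at
  most a fraction \<delta> / 4 of all sets, so on average a set has at most \<delta> / 4 times
  \<open>card V\<close> such vertices, and at most half of the sets have more than twice
  that.\<close>

lemma card_sets_with_few_low_degrees_ge:
  fixes \<delta> :: real
  assumes V: "finite V" "V \<noteq> {}" and E: "E \<in> regular_edge_sets V d"
    and \<delta>: "\<delta> > 0" "(3 / 4) ^ d * 2 ^ K \<le> \<delta> / 4"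
  shows "2 ^ card V \<le> 2 * real (card {U \<in> Pow V.
    real (card {v \<in> V. card (nbrs E v \<inter> U) < K}) \<le> \<delta> / 2 * card V})"
proof -
  let ?low = "\<lambda>U. card {v \<in> V. card (nbrs E v \<inter> U) < K}"
  define T where "T = {U \<in> Pow V. real (?low U) \<le> \<delta> / 2 * card V}"
  define n where "n = card V"
  have n0: "n > 0" using V by (simp add: n_def card_gt_0_iff)
  have finPow: "finite (Pow V)" using V by simp
  have T: "T \<subseteq> Pow V" by (auto simp: T_def)
  have "real (card (Pow V - T)) * (\<delta> / 2 * n) = (\<Sum>U\<in>Pow V - T. \<delta> / 2 * n)" by simp
  also have "\<dots> \<le> (\<Sum>U\<in>Pow V - T. real (?low U))"
    by (rule sum_mono) (auto simp: T_def n_def)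
  also have "\<dots> \<le> (\<Sum>U\<in>Pow V. real (?low U))"
    using finPow by (intro sum_mono2) auto
  also have "\<dots> = real (\<Sum>U\<in>Pow V. ?low U)" by simp
  \<comment> \<open>The pairs of a set and a vertex of low degree into it are counted by vertices
    instead of sets.\<close>
  also have "(\<Sum>U\<in>Pow V. ?low U) = (\<Sum>v\<in>V. card {U \<in> Pow V. card (nbrs E v \<inter> U) < K})"
    by (rule sum_multicount_gen) (use V finPow in auto)
  also have "real \<dots> = (\<Sum>v\<in>V. real (card {U \<in> Pow V. card (nbrs E v \<inter> U) < K}))" by simp
  also have "\<dots> \<le> (\<Sum>v\<in>V. 2 ^ n * (\<delta> / 4))"
  proof (rule sum_mono)
    fix v assume v: "v \<in> V"
    have E': "E \<subseteq> edges_on V" and deg: "card (nbrs E v) = d"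
      using E v by (auto simp: regular_edge_sets_def)
    have "real (card {U \<in> Pow V. card (nbrs E v \<inter> U) < K}) \<le> 2 ^ n * ((3 / 4) ^ d * 2 ^ K)"
      using card_sets_meeting_in_few_le[OF V(1) nbrs_subset[OF E'], of v K]
      unfolding deg n_def .
    also have "\<dots> \<le> 2 ^ n * (\<delta> / 4)" by (intro mult_left_mono \<delta>) simp
    finally show "real (card {U \<in> Pow V. card (nbrs E v \<inter> U) < K}) \<le> 2 ^ n * (\<delta> / 4)" .
  qed
  also have "\<dots> = (2 ^ n / 2) * (\<delta> / 2 * n)" by (simp add: n_def)
  finally have "real (card (Pow V - T)) * (\<delta> / 2 * n) \<le> (2 ^ n / 2) * (\<delta> / 2 * n)" .
  then have "real (card (Pow V - T)) \<le> 2 ^ n / 2"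
    using \<delta>(1) n0 by (simp only: mult_le_cancel_right) auto
  moreover have "2 ^ n = real (card T) + real (card (Pow V - T))"
  proof -
    have "card T + card (Pow V - T) = 2 ^ n"
      using T V finPow card_mono[OF finPow T]
      by (simp add: card_Diff_subset finite_subset card_Pow n_def)
    then have "real (card T + card (Pow V - T)) = real (2 ^ n)" by (rule arg_cong)
    then show ?thesis by simp
  qed
  ultimately have "2 ^ n \<le> 2 * real (card T)" by linarith
  then show ?thesis by (simp add: T_def n_def)
qed

text \<open>Taking the symmetric difference with \<open>U\<close> is injective, so only small
  subsets have to be counted. It matters that \<delta> depends on \<epsilon> alone and serves every
  \<open>V\<close>.\<close>

lemma ex_card_nearby_sets_le:
  fixes \<epsilon> :: real
  assumes "\<epsilon> > 0" "\<epsilon> \<le> 1"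
  obtains \<delta> :: real where "\<delta> > 0"
    "\<And>(V :: 'a set) U. finite V \<Longrightarrow> U \<subseteq> V \<Longrightarrow>
      real (card {W \<in> Pow V. real (card (sym_diff U W)) \<le> 2 * \<delta> * card V}) \<le> 2 powr (\<epsilon> / 2 * card V)"
proof -
  \<comment> \<open>Half of the exponent is spent here: \<open>(1 + x) ^ card V\<close> is 2 to the
    power \<epsilon> / 4 times \<open>card V\<close>.\<close>
  define x :: real where "x = 2 powr (\<epsilon> / 4) - 1"
  have "(2::real) powr (\<epsilon> / 4) > 2 powr 0" "(2::real) powr (\<epsilon> / 4) < 2 powr 1"
    using assms by (intro powr_less_mono; simp)+
  then have x: "0 < x" "x < 1" by (auto simp: x_def)
  \<comment> \<open>Chosen so that \<open>1 / x powr m\<close> takes exactly the other half of the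
    exponent; \<open>log 2 x\<close> is negative.\<close>
  define \<delta> where "\<delta> = \<epsilon> / (- 8 * log 2 x)"
  have log: "log 2 x < 0" using x by simp
  then have \<delta>0: "\<delta> > 0" using assms by (simp add: \<delta>_def divide_pos_neg)
  have "real (card {W \<in> Pow V. real (card (sym_diff U W)) \<le> 2 * \<delta> * card V}) \<le> 2 powr (\<epsilon> / 2 * card V)"
    if V: "finite V" and U: "U \<subseteq> V" for V U :: "'a set"
  proof -
    define m where "m = 2 * \<delta> * card V"
    let ?A = "{X. X \<subseteq> V \<and> real (card X) \<le> m}"
    have "card {W \<in> Pow V. real (card (sym_diff U W)) \<le> m} \<le> card ?A"
    proof (rule card_inj_on_le[of "\<lambda>W. sym_diff U W"])
      show "inj_on (\<lambda>W. sym_diff U W) {W \<in> Pow V. real (card (sym_diff U W)) \<le> m}"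
        by (rule inj_onI) blast
      show "(\<lambda>W. sym_diff U W) ` {W \<in> Pow V. real (card (sym_diff U W)) \<le> m} \<subseteq> ?A"
        using U by blast
    qed (use V in simp)
    then have le: "real (card {W \<in> Pow V. real (card (sym_diff U W)) \<le> m}) \<le> real (card ?A)"
      by (rule of_nat_mono)
    have "real (card ?A) * x powr m \<le> (1 + x) ^ card V"
      using card_small_subsets_le[OF V] x by simp
    then have "real (card ?A) \<le> (1 + x) ^ card V / x powr m"
      using x by (simp add: pos_le_divide_eq)
    also have "(1 + x) ^ card V = 2 powr (\<epsilon> / 4 * card V)"
      by (simp add: x_def powr_powr flip: powr_realpow)
    also have "x powr m = 2 powr (log 2 x * m)"
      using x by (simp flip: powr_powr)
    also have "log 2 x * m = - (\<epsilon> / 4 * card V)"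
      using log by (simp add: m_def \<delta>_def field_simps)
    also have "2 powr (\<epsilon> / 4 * card V) / 2 powr (- (\<epsilon> / 4 * card V)) = 2 powr (\<epsilon> / 2 * card V)"
      by (simp flip: powr_diff)
    finally show ?thesis using le by (simp add: m_def)
  qed
  then show ?thesis using \<delta>0 that by blast
qed

section \<open>Existence of regular graphs\<close>

text \<open>The connection set of a circulant graph: the \<open>d div 2\<close> smallest and largest
  nonzero residues, together with \<open>n / 2\<close> when \<open>d\<close> is odd, in which case
  \<open>n\<close> is even.\<close>

lemma ex_symmetric_residue_set:
  fixes n d :: nat
  assumes "d < n" "even (d * n)"
  obtains S :: "int set" where "S \<subseteq> {1..<int n}" "\<And>s. s \<in> S \<Longrightarrow> int n - s \<in> S" "card S = d"
proof -
  define h where "h = d div 2"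
  define A B C where "A = {1..int h}" and "B = {int n - int h..int n - 1}"
    and "C = {s. odd d \<and> 2 * s = int n}"
  have h: "2 * h \<le> d" "odd d \<Longrightarrow> d = 2 * h + 1" "even d \<Longrightarrow> d = 2 * h"
    by (auto simp: h_def)
  have C: "C = (if odd d then {int (n div 2)} else {})" "odd d \<Longrightarrow> int n = 2 * int (n div 2)"
    using assms(2) by (auto simp: C_def)
  have "h < n" using h assms by linarith
  show ?thesis
  proof
    show "A \<union> B \<union> C \<subseteq> {1..<int n}"
      using h assms by (auto simp: A_def B_def C_def)
    show "int n - s \<in> A \<union> B \<union> C" if "s \<in> A \<union> B \<union> C" for s
      using that by (auto simp: A_def B_def C_def)
    have "A \<inter> B = {}" using h assms by (auto simp: A_def B_def)
    moreover have "(A \<union> B) \<inter> C = {}" using h assms by (auto simp: A_def B_def C_def)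
    moreover have "finite A" "finite B" "finite C" using C by (auto simp: A_def B_def)
    ultimately have "card (A \<union> B \<union> C) = card A + card B + card C"
      by (simp add: card_Un_disjoint)
    also have "\<dots> = d" using h C by (cases "even d") (auto simp: A_def B_def)
    finally show "card (A \<union> B \<union> C) = d" .
  qed
qed

text \<open>The witness is a circulant graph: symmetry of \<open>S\<close> makes adjacency
  symmetric, 0 is not in \<open>S\<close>, and \<open>r v\<close> maps the neighbours of
  \<open>v\<close> bijectively to \<open>S\<close>. Nonemptiness is what makes
  \<open>pmf_of_set\<close> the uniform distribution.\<close>

lemma regular_edge_sets_nonempty:
  assumes "d < n" "even (d * n)"
  shows "regular_edge_sets {1..n} d \<noteq> {}"
proof -
  obtain S :: "int set" where S: "S \<subseteq> {1..<int n}" "\<And>s. s \<in> S \<Longrightarrow> int n - s \<in> S" "card S = d"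
    using ex_symmetric_residue_set[OF assms] by blast
  define r where "r u v = (int v - int u) mod int n" for u v :: nat
  define E where "E = {{u, v} | u v. u \<in> {1..n} \<and> v \<in> {1..n} \<and> r u v \<in> S}"
  have r_sym: "r v u \<in> S" if "r u v \<in> S" for u v
  proof -
    have "r u v \<noteq> 0" using that S(1) by auto
    then have "r v u = int n - r u v"
      using zmod_zminus1_eq_if[of "int v - int u" "int n"] by (simp add: r_def)
    then show ?thesis using S(2)[OF that] by simp
  qed
  have "r u u \<notin> S" for u using S(1) by (auto simp: r_def)
  then have "E \<subseteq> edges_on {1..n}"
    unfolding E_def by (auto simp: doubleton_in_edges_on)
  moreover have "card (nbrs E v) = d" if v: "v \<in> {1..n}" for v
  proof -
    have nb: "nbrs E v = {w \<in> {1..n}. r v w \<in> S}"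
      using v by (auto simp: nbrs_def E_def doubleton_eq_iff dest: r_sym)
    have "bij_betw (r v) (nbrs E v) S"
      unfolding bij_betw_def
    proof
      show "inj_on (r v) (nbrs E v)"
      proof (rule inj_onI)
        fix w w' assume w: "w \<in> nbrs E v" "w' \<in> nbrs E v" and eq: "r v w = r v w'"
        have "(int w - int v) mod int n = (int w' - int v) mod int n" using eq by (simp add: r_def)
        then have "int n dvd (int w - int v) - (int w' - int v)" by (simp only: mod_eq_dvd_iff)
        then have "int n dvd int w - int w'" by simp
        moreover have "\<bar>int w - int w'\<bar> < int n" using w by (auto simp: nb)
        ultimately show "w = w'" using zdvd_not_zless[of "\<bar>int w - int w'\<bar>" "int n"] by auto
      qed
      show "r v ` nbrs E v = S"
      proof
        show "r v ` nbrs E v \<subseteq> S" by (auto simp: nb)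
        show "S \<subseteq> r v ` nbrs E v"
        proof
          fix s assume s: "s \<in> S"
          \<comment> \<open>The vertex \<open>v + s\<close> modulo \<open>n\<close>, shifted because
            the representatives are 1 to \<open>n\<close> and not 0 to \<open>n - 1\<close>.\<close>
          define w where "w = nat ((int v + s - 1) mod int n) + 1"
          have n: "int n > 0" using v by auto
          have w: "int w = (int v + s - 1) mod int n + 1" using n by (simp add: w_def)
          have "(int v + s - 1) mod int n < int n" using n by simp
          then have "int w \<le> int n" using w by linarith
          then have "w \<le> n" by (simp only: of_nat_le_iff)
          moreover have "1 \<le> w" by (simp add: w_def)
          ultimately have "w \<in> {1..n}" by simp
          moreover
          have "r v w = s"
          proof -
            have "r v w = ((int v + s - 1) mod int n + (1 - int v)) mod int n"
              by (simp add: r_def w algebra_simps)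
            also have "\<dots> = s mod int n" by (simp add: mod_add_left_eq)
            also have "\<dots> = s" using s S(1) by (auto simp: subset_iff)
            finally show ?thesis .
          qed
          ultimately show "s \<in> r v ` nbrs E v" using s by (auto simp: nb image_iff)
        qed
      qed
    qed
    then show ?thesis using S(3) bij_betw_same_card by metis
  qed
  ultimately show ?thesis unfolding regular_edge_sets_def by blast
qed

section \<open>Counting isomorphism classes\<close>

definition graph_of_edges :: "nat \<Rightarrow> nat set set \<Rightarrow> nat pair_pre_digraph" where
  "graph_of_edges n E = \<lparr>pverts = {1..n}, parcs = {(u, v). {u, v} \<in> E}\<rparr>"

lemma out_degree_graph_of_edges: "out_degree (with_proj (graph_of_edges n E)) v = card (nbrs E v)"
proof -
  have "out_arcs (with_proj (graph_of_edges n E)) v = Pair v ` nbrs E v"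
    by (auto simp: out_arcs_def graph_of_edges_def nbrs_def)
  then show ?thesis by (simp add: out_degree_def card_image inj_on_def)
qed

lemma pair_graph_graph_of_edges:
  assumes E: "E \<subseteq> edges_on {1..n}"
  shows "pair_graph (graph_of_edges n E)"
proof
  show "finite (parcs (graph_of_edges n E))"
    using finite_subset[OF E finite_edges_on] card_ordered_pairs_le(1)[of E]
    by (simp add: graph_of_edges_def)
  show "symmetric (with_proj (graph_of_edges n E))"
    by (auto simp: symmetric_def sym_def graph_of_edges_def insert_commute)
qed (use edge_memD[OF E] in \<open>force simp: graph_of_edges_def\<close>)+

text \<open>Together with \<open>inj_on_graph_of_edges\<close> this turns probabilities for the
  random regular graph into ratios of numbers of edge sets.\<close>

lemma regular_graphs_eq: "regular_graphs n d = graph_of_edges n ` regular_edge_sets {1..n} d"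
proof (rule equalityI; rule subsetI)
  fix G assume G: "G \<in> regular_graphs n d"
  then interpret pair_graph G by (simp add: regular_graphs_def)
  define E where "E = {{u, v} | u v. (u, v) \<in> parcs G}"
  have sym: "(v, u) \<in> parcs G" if "(u, v) \<in> parcs G" for u v
    using pair_sym_arcs that by (auto simp: symmetric_def sym_def)
  have pv: "pverts G = {1..n}" using G by (simp add: regular_graphs_def)
  have "parcs G = {(u, v). {u, v} \<in> E}"
    by (auto simp: E_def doubleton_eq_iff dest: sym)
  then have GE: "G = graph_of_edges n E"
    using pv by (simp add: graph_of_edges_def)
  have "E \<subseteq> edges_on {1..n}"
    using in_arcsD1 in_arcsD2 pair_no_loops pv
    by (fastforce simp: E_def doubleton_in_edges_on)
  moreover have "card (nbrs E v) = d" if "v \<in> {1..n}" for v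
  proof -
    have "out_degree (with_proj G) v = d" using G that pv by (simp add: regular_graphs_def)
    then show ?thesis unfolding GE out_degree_graph_of_edges .
  qed
  ultimately have "E \<in> regular_edge_sets {1..n} d" by (simp add: regular_edge_sets_def)
  then show "G \<in> graph_of_edges n ` regular_edge_sets {1..n} d" using GE by blast
next
  fix G assume "G \<in> graph_of_edges n ` regular_edge_sets {1..n} d"
  then obtain E where G: "G = graph_of_edges n E" and E: "E \<in> regular_edge_sets {1..n} d" by blast
  have "pair_graph G"
    using E unfolding G by (intro pair_graph_graph_of_edges) (simp add: regular_edge_sets_def)
  then show "G \<in> regular_graphs n d"
    using E unfolding G regular_graphs_def mem_Collect_eq out_degree_graph_of_edges
    by (simp add: regular_edge_sets_def graph_of_edges_def)
qed

lemma inj_on_graph_of_edges: "inj_on (graph_of_edges n) (regular_edge_sets {1..n} d)"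
proof (rule inj_onI)
  fix E E' assume E: "E \<in> regular_edge_sets {1..n} d" "E' \<in> regular_edge_sets {1..n} d"
    and "graph_of_edges n E = graph_of_edges n E'"
  then have "{u, v} \<in> E \<longleftrightarrow> {u, v} \<in> E'" for u v
    by (auto simp: graph_of_edges_def set_eq_iff)
  moreover have "\<exists>u v. e = {u, v}" if "e \<in> E \<union> E'" for e
  proof -
    have "e \<in> edges_on {1..n}" using that E unfolding regular_edge_sets_def by blast
    then show ?thesis by (blast elim: edges_onE)
  qed
  ultimately show "E = E'" by blast
qed

text \<open>\<open>T\<close> splits into fibres of the map that sends a set to the isomorphism class
  of its induced subgraph. There are at most \<open>mu G\<close> fibres, and each has at most
  \<open>b\<close> members; only partners inside \<open>T\<close> have to be counted.\<close>

lemma card_le_mu_times: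
  fixes b :: real
  assumes fin: "finite (pverts G)" and T: "T \<subseteq> Pow (pverts G)"
    and b: "\<And>U. U \<in> T \<Longrightarrow> real (card {W \<in> T. \<exists>f. bij_betw f U W \<and>
      (\<forall>u\<in>U. \<forall>v\<in>U. (u, v) \<in> parcs G \<longleftrightarrow> (f u, f v) \<in> parcs G)}) \<le> b" and b0: "b \<ge> 0"
  shows "real (card T) \<le> real (mu G) * b"
proof -
  let ?H = "\<lambda>U. induce_subgraph (with_proj G) U"
  define c where "c U = induced_iso_rel G `` {?H U}" for U
  have "induced_subgraphs G = ?H ` Pow (pverts G)" by (auto simp: induced_subgraphs_def)
  then have finI: "finite (induced_subgraphs G)" using fin by simp
  have finQ: "finite (induced_subgraphs G // induced_iso_rel G)"
    using finI by (simp add: quotient_def)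
  have H: "?H U \<in> induced_subgraphs G" if "U \<in> T" for U
    using that T by (auto simp: induced_subgraphs_def)
  then have cQ: "c ` T \<subseteq> induced_subgraphs G // induced_iso_rel G"
    by (auto simp: c_def intro: quotientI)
  have finT: "finite T" using T fin by (simp add: finite_subset)
  have fiber: "real (card {W \<in> T. c W = q}) \<le> b" if q: "q \<in> c ` T" for q
  proof -
    obtain U where U: "U \<in> T" "q = c U" using q by blast
    have "{W \<in> T. c W = q} \<subseteq> {W \<in> T. \<exists>f. bij_betw f U W \<and>
      (\<forall>u\<in>U. \<forall>v\<in>U. (u, v) \<in> parcs G \<longleftrightarrow> (f u, f v) \<in> parcs G)}"
    proof clarify
      fix W assume W: "W \<in> T" "q = c W"
      then have "(?H U, ?H W) \<in> induced_iso_rel G"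
        using U H equiv_induced_iso_rel[of G] unfolding c_def
        by (metis eq_equiv_class_iff)
      then have "digraph_iso (?H U) (?H W)" by (simp add: induced_iso_rel_def)
      then show "\<exists>f. bij_betw f U W \<and>
          (\<forall>u\<in>U. \<forall>v\<in>U. (u, v) \<in> parcs G \<longleftrightarrow> (f u, f v) \<in> parcs G)"
        by (simp only: digraph_iso_induce_subgraph_iff)
    qed
    then have "card {W \<in> T. c W = q} \<le> card {W \<in> T. \<exists>f. bij_betw f U W \<and>
      (\<forall>u\<in>U. \<forall>v\<in>U. (u, v) \<in> parcs G \<longleftrightarrow> (f u, f v) \<in> parcs G)}"
      using finT by (intro card_mono) auto
    then show ?thesis using b[OF U(1)] by linarith
  qed
  have "T = (\<Union>q\<in>c ` T. {W \<in> T. c W = q})" by blast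
  then have "card T \<le> (\<Sum>q\<in>c ` T. card {W \<in> T. c W = q})"
    using card_UN_le[of "c ` T" "\<lambda>q. {W \<in> T. c W = q}"] finT by simp
  then have "real (card T) \<le> (\<Sum>q\<in>c ` T. real (card {W \<in> T. c W = q}))"
    by (simp only: of_nat_le_iff flip: of_nat_sum)
  also have "\<dots> \<le> (\<Sum>q\<in>c ` T. b)" by (rule sum_mono[OF fiber])
  also have "\<dots> = real (card (c ` T)) * b" by simp
  also have "\<dots> \<le> real (mu G) * b"
    unfolding mu_def using card_mono[OF finQ cQ] b0 by (intro mult_right_mono of_nat_mono)
  finally show ?thesis .
qed

text \<open>Here \<open>T\<close> consists of the typical sets, at least half of all sets. By
  \<open>few_moved_vertices\<close> an isomorphism between two of them moves few vertices, so all
  partners of \<open>U\<close> are close to \<open>U\<close>, and \<open>b\<close> bounds their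
  number.\<close>

lemma two_power_le_mu:
  fixes \<delta> b :: real
  assumes n: "n > 0" and E: "E \<in> regular_edge_sets {1..n} d"
    and not: "\<not> has_moved_copy {1..n} (2 * n) E"
    and \<delta>: "\<delta> > 0" "28 \<le> real K * \<delta>" "(3 / 4) ^ d * 2 ^ K \<le> \<delta> / 4"
    and b: "\<And>U. U \<subseteq> {1..n} \<Longrightarrow>
      real (card {W \<in> Pow {1..n}. real (card (sym_diff U W)) \<le> 2 * \<delta> * n}) \<le> b"
  shows "2 ^ n \<le> 2 * (real (mu (graph_of_edges n E)) * b)"
proof -
  let ?V = "{1..n}" and ?G = "graph_of_edges n E"
  define T where "T = {U \<in> Pow ?V. real (card {v \<in> ?V. card (nbrs E v \<inter> U) < K}) \<le> \<delta> / 2 * n}"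
  have E': "E \<subseteq> edges_on ?V" using E by (simp add: regular_edge_sets_def)
  have "2 ^ n \<le> 2 * real (card T)"
    using card_sets_with_few_low_degrees_ge[of ?V E d \<delta> K] n E \<delta> by (simp add: T_def)
  moreover have "real (card T) \<le> real (mu ?G) * b"
  proof (rule card_le_mu_times)
    fix U assume U: "U \<in> T"
    then have UV: "U \<subseteq> ?V" by (auto simp: T_def)
    have "{W \<in> T. \<exists>f. bij_betw f U W \<and>
        (\<forall>u\<in>U. \<forall>v\<in>U. (u, v) \<in> parcs ?G \<longleftrightarrow> (f u, f v) \<in> parcs ?G)}
      \<subseteq> {W \<in> Pow ?V. real (card (sym_diff U W)) \<le> 2 * \<delta> * n}"
    proof
      fix W assume "W \<in> {W \<in> T. \<exists>f. bij_betw f U W \<and>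
        (\<forall>u\<in>U. \<forall>v\<in>U. (u, v) \<in> parcs ?G \<longleftrightarrow> (f u, f v) \<in> parcs ?G)}"
      then obtain f where W: "W \<in> T" and f: "bij_betw f U W"
        and adj: "\<forall>u\<in>U. \<forall>v\<in>U. (u, v) \<in> parcs ?G \<longleftrightarrow> (f u, f v) \<in> parcs ?G"
        by blast
      have WV: "W \<subseteq> ?V" using W by (auto simp: T_def)
      let ?M = "{u \<in> U. f u \<noteq> u}"
      have "finite U" using UV by (rule finite_subset) simp
      then have finM: "finite ?M" by simp
      have "real (card ?M) < \<delta> * card ?V"
      proof (rule few_moved_vertices[OF _ E' _ UV])
        show "f \<in> U \<rightarrow> ?V" "inj_on f U" using f WV by (auto simp: bij_betw_def)
        show "{f u, f v} \<in> E" if "{u, v} \<in> E" "u \<in> U" "v \<in> U" for u v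
          using adj that by (auto simp: graph_of_edges_def)
      qed (use U not \<delta> n in \<open>auto simp: T_def\<close>)
      moreover have "W = f ` U" using f by (simp add: bij_betw_def)
      \<comment> \<open>A vertex of \<open>U\<close> outside \<open>W\<close> cannot be fixed by
        \<open>f\<close>, and a vertex of \<open>W\<close> outside \<open>U\<close> is the image of
        a moved one.\<close>
      then have "sym_diff U W \<subseteq> ?M \<union> f ` ?M" by (auto, metis imageI)
      then have "card (sym_diff U W) \<le> card (?M \<union> f ` ?M)"
        using finM by (intro card_mono) auto
      then have "card (sym_diff U W) \<le> card ?M + card ?M"
        using card_Un_le[of ?M "f ` ?M"] card_image_le[OF finM, of f] by linarith
      ultimately show "W \<in> {W \<in> Pow ?V. real (card (sym_diff U W)) \<le> 2 * \<delta> * n}"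
        using WV by simp
    qed
    then have "card {W \<in> T. \<exists>f. bij_betw f U W \<and>
        (\<forall>u\<in>U. \<forall>v\<in>U. (u, v) \<in> parcs ?G \<longleftrightarrow> (f u, f v) \<in> parcs ?G)}
      \<le> card {W \<in> Pow ?V. real (card (sym_diff U W)) \<le> 2 * \<delta> * n}"
      by (intro card_mono) auto
    then show "real (card {W \<in> T. \<exists>f. bij_betw f U W \<and>
        (\<forall>u\<in>U. \<forall>v\<in>U. (u, v) \<in> parcs ?G \<longleftrightarrow> (f u, f v) \<in> parcs ?G)}) \<le> b"
      using b[OF UV] by linarith
  next
    show "b \<ge> 0" using b[of "{}"] by (meson empty_subsetI of_nat_0_le_iff order_trans)
  qed (auto simp: graph_of_edges_def T_def)
  ultimately show ?thesis by linarith
qed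

section \<open>Choice of the constants and passage to the limit\<close>

theorem theorem2:
  shows "\<forall>\<epsilon>::real. \<epsilon> > 0 \<longrightarrow> (\<exists>d0::nat. \<forall>d::nat. d \<ge> d0 \<longrightarrow>
    ((\<lambda>n::nat. measure_pmf.prob (random_regular_graph n d)
        {G. real (mu G) \<ge> 2 powr ((1 - \<epsilon>) * real n)}) \<longlongrightarrow> 1)
      (inf sequentially (principal {n. even (d * n)})))"
proof (intro allI impI)
  fix \<epsilon> :: real assume \<epsilon>: "\<epsilon> > 0"
  \<comment> \<open>The count of nearby sets is available for exponents up to 1; lowering \<epsilon>
    only strengthens the claim.\<close>
  define \<eta> where "\<eta> = min \<epsilon> 1"
  have \<eta>: "\<eta> > 0" "\<eta> \<le> 1" "\<eta> \<le> \<epsilon>" using \<epsilon> by (auto simp: \<eta>_def)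
  obtain \<delta> :: real where \<delta>: "\<delta> > 0" and near: "\<And>(V :: nat set) U. finite V \<Longrightarrow> U \<subseteq> V \<Longrightarrow>
      real (card {W \<in> Pow V. real (card (sym_diff U W)) \<le> 2 * \<delta> * card V}) \<le> 2 powr (\<eta> / 2 * card V)"
    using ex_card_nearby_sets_le[OF \<eta>(1,2), where 'a = nat] by blast
  \<comment> \<open>The constants are fixed in the order \<eta>, \<delta>, \<open>K\<close>,
    \<open>d\<close>: \<open>K\<close> is large in terms of \<delta>, and then \<open>d\<close> is
    so large that few sets are atypical.\<close>
  define K where "K = nat \<lceil>28 / \<delta>\<rceil>"
  have "28 / \<delta> \<le> real K" by (simp add: K_def real_nat_ceiling_ge)
  then have K: "28 \<le> real K * \<delta>" using \<delta> by (simp add: pos_divide_le_eq)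
  have "(\<lambda>d. (3 / 4 :: real) ^ d * 2 ^ K) \<longlonglongrightarrow> 0 * 2 ^ K"
    by (intro tendsto_mult tendsto_const LIMSEQ_power_zero) simp
  then have "eventually (\<lambda>d. (3 / 4 :: real) ^ d * 2 ^ K < \<delta> / 4) sequentially"
    using \<delta> by (intro order_tendstoD(2)[of _ "0 * 2 ^ K"]) auto
  then obtain d1 where d1: "\<And>d. d \<ge> d1 \<Longrightarrow> (3 / 4 :: real) ^ d * 2 ^ K < \<delta> / 4"
    by (auto simp: eventually_sequentially)
  show "\<exists>d0::nat. \<forall>d::nat. d \<ge> d0 \<longrightarrow>
    ((\<lambda>n::nat. measure_pmf.prob (random_regular_graph n d)
        {G. real (mu G) \<ge> 2 powr ((1 - \<epsilon>) * real n)}) \<longlongrightarrow> 1)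
      (inf sequentially (principal {n. even (d * n)}))"
  \<comment> \<open>32 serves the bound on moved copies, \<open>d1\<close> the count of typical
    sets.\<close>
  proof (intro exI[of _ "max 32 d1"] allI impI)
    fix d assume "max 32 d1 \<le> d"
    then have d: "32 \<le> d" "(3 / 4 :: real) ^ d * 2 ^ K \<le> \<delta> / 4" using d1[of d] by auto
    let ?P = "\<lambda>n. measure_pmf.prob (random_regular_graph n d)
        {G. real (mu G) \<ge> 2 powr ((1 - \<epsilon>) * real n)}"
    \<comment> \<open>The three thresholds on \<open>n\<close> serve the bound on moved copies, the
      existence of a \<open>d\<close>-regular graph, and the absorption of a factor 2 into the
      exponent.\<close>
    have bound: "1 - (1 / 2) ^ n \<le> ?P n"
      if n: "72 * d ^ 4 \<le> n" "d < n" "2 / \<eta> \<le> real n" and even: "even (d * n)" for n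
    proof -
      let ?R = "regular_edge_sets {1..n} d"
      let ?bad = "{E \<in> ?R. has_moved_copy {1..n} (2 * n) E}"
      have finR: "finite ?R" by (rule finite_regular_edge_sets) simp
      have R: "card ?R > 0"
        using regular_edge_sets_nonempty[OF n(2) even] finR by (simp add: card_gt_0_iff)
      have cardR: "card (regular_graphs n d) = card ?R"
        unfolding regular_graphs_eq by (rule card_image[OF inj_on_graph_of_edges])
      have mu: "2 powr ((1 - \<epsilon>) * real n) \<le> real (mu (graph_of_edges n E))" if E: "E \<in> ?R - ?bad" for E
      proof -
        have "2 ^ n \<le> 2 * (real (mu (graph_of_edges n E)) * 2 powr (\<eta> / 2 * n))"
          using E n near[of "{1..n}"] \<delta> K d(2) by (intro two_power_le_mu) auto
        moreover have "2 * 2 powr ((1 - \<epsilon>) * real n) * 2 powr (\<eta> / 2 * n) \<le> 2 ^ n"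
        proof -
          \<comment> \<open>The factor 2 lost by keeping only typical sets costs one unit in the
            exponent, which the unspent \<eta> n / 2 covers.\<close>
          have "1 \<le> \<eta> / 2 * n" using n(3) \<eta>(1) by (simp add: field_simps)
          moreover have "\<eta> * n \<le> \<epsilon> * n" using \<eta>(3) by (intro mult_right_mono) auto
          ultimately have "1 + (1 - \<epsilon>) * real n + \<eta> / 2 * n \<le> real n"
            by (simp add: algebra_simps)
          then have "2 powr (1 + (1 - \<epsilon>) * real n + \<eta> / 2 * n) \<le> 2 powr real n"
            by (intro powr_mono) auto
          then show ?thesis by (simp add: powr_add powr_realpow)
        qed
        ultimately have "2 powr ((1 - \<epsilon>) * real n) * (2 * 2 powr (\<eta> / 2 * n))
            \<le> real (mu (graph_of_edges n E)) * (2 * 2 powr (\<eta> / 2 * n))" by linarith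
        then show ?thesis by (rule mult_right_le_imp_le) simp
      qed
      have "real (card ?bad) \<le> (1 / 2) ^ n * real (card ?R)"
        using card_has_moved_copy_le_half_power[of "{1..n}" d] d n by simp
      moreover have "card (?R - ?bad) = card ?R - card ?bad" "card ?bad \<le> card ?R"
        using finR by (auto intro!: card_Diff_subset card_mono)
      ultimately have "(1 - (1 / 2) ^ n) * real (card ?R) \<le> real (card (?R - ?bad))"
        by (simp add: of_nat_diff algebra_simps)
      also have "card (?R - ?bad) = card (graph_of_edges n ` (?R - ?bad))"
        by (rule card_image[symmetric], rule inj_on_subset[OF inj_on_graph_of_edges]) blast
      also have "\<dots> \<le> card (regular_graphs n d \<inter> {G. real (mu G) \<ge> 2 powr ((1 - \<epsilon>) * real n)})"
        using mu by (intro card_mono) (auto simp: finite_regular_graphs, auto simp: regular_graphs_eq)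
      finally have "1 - (1 / 2) ^ n \<le>
          real (card (regular_graphs n d \<inter> {G. real (mu G) \<ge> 2 powr ((1 - \<epsilon>) * real n)})) /
          real (card ?R)"
        using R by (simp add: pos_le_divide_eq)
      also have "\<dots> = ?P n"
        unfolding random_regular_graph_def using R cardR
        by (subst measure_pmf_of_set) (auto simp: finite_regular_graphs card_gt_0_iff)
      finally show ?thesis .
    qed
    have "eventually (\<lambda>n. real n \<ge> 2 / \<eta>) sequentially"
      by (rule eventually_sequentiallyI[of "nat \<lceil>2 / \<eta>\<rceil>"]) linarith
    then have "eventually (\<lambda>n. 72 * d ^ 4 \<le> n \<and> d < n \<and> 2 / \<eta> \<le> real n) sequentially"
      by (intro eventually_conj eventually_ge_at_top eventually_gt_at_top)
    then have "eventually (\<lambda>n. 1 - (1 / 2) ^ n \<le> ?P n) (inf sequentially (principal {n. even (d * n)}))"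
      unfolding eventually_inf_principal by (rule eventually_mono) (auto intro: bound)
    moreover have "(\<lambda>n. 1 - (1 / 2 :: real) ^ n) \<longlonglongrightarrow> 1 - 0"
      by (intro tendsto_diff tendsto_const LIMSEQ_power_zero) simp
    then have "((\<lambda>n. 1 - (1 / 2 :: real) ^ n) \<longlongrightarrow> 1) (inf sequentially (principal {n. even (d * n)}))"
      by (intro tendsto_mono[OF inf_le1]) simp
    ultimately show "(?P \<longlongrightarrow> 1) (inf sequentially (principal {n. even (d * n)}))"
      by (intro tendsto_sandwich[of "\<lambda>n. 1 - (1 / 2) ^ n" ?P _ "\<lambda>_. 1"])
        (auto intro: always_eventually measure_pmf.prob_le_1)
  qed
qed

end
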